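(* Let $n$ be a positive integer. The integer root quadruples $(-n,x,y,z)$ with $-n<0\le x\le y\le z$ are in one-to-one correspondence with the reduced positive definite integral binary quadratic forms of discriminant $-4n^2$ having nonnegative middle coefficient. The reduced binary quadratic form $[A,B,C]=AT^2+2BTU+CU^2$ associated to $(-n,x,y,z)$ is given by $$[A,B,C]:=\left[-n+x,\ \tfrac12(-n+x+y-z),\ -n+y\right].$$ Primitive root quadruples correspond to primitive reduced binary quadratic forms having nonnegative middle coefficient. In particular, the number $N^*_{root}(-n)$ of primitive root quadruples with least element $-n$ satisfies $$N^*_{root}(-n)=h^{\pm}(-4n^2),$$ where $h^{\pm}(-4n^2)$ is the number of $GL(2,\mathbb Z)$-equivalence classes of positive definite primitive binary integral forms of discriminant $-4n^2$.
   Context: An integer Descartes quadruple is $(a,b,c,d)\in\mathbb Z^4$ with $2(a^2+b^2+c^2+d^2)=(a+b+c+d)^2$; it is primitive if $\gcd(a,b,c,d)=1$. A Descartes quadruple with $a+b+c+d>0$ is a root quadruple if $a\le0\le b\le c\le d$ and $a+b+c\ge d$. Binary quadratic forms are written $[A,B,C]=AT^2+2BTU+CU^2$ with $A,B,C\in\mathbb Z$, and have discriminant $4B^2-4AC$; the form is primitive if $\gcd(A,B,C)=1$. A positive definite form $[A,B,C]$ is reduced if $0\le|2B|\le A\le C$; its middle coefficient is nonnegative if $B\ge0$. $GL(2,\mathbb Z)$ acts on forms by linear change of the variables $(T,U)$. *)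

theory Defs
  imports "HOL-Analysis.Finite_Cartesian_Product" "HOL-Analysis.Cartesian_Space"
begin

definition descartes_quadruple :: "int \<times> int \<times> int \<times> int \<Rightarrow> bool" where
  "descartes_quadruple = (\<lambda>(a, b, c, d).
     2 * (a\<^sup>2 + b\<^sup>2 + c\<^sup>2 + d\<^sup>2) = (a + b + c + d)\<^sup>2)"

definition primitive_quadruple :: "int \<times> int \<times> int \<times> int \<Rightarrow> bool" where
  "primitive_quadruple = (\<lambda>(a, b, c, d). Gcd {a, b, c, d} = 1)"

definition root_quadruple :: "int \<times> int \<times> int \<times> int \<Rightarrow> bool" where
  "root_quadruple = (\<lambda>(a, b, c, d).
     descartes_quadruple (a, b, c, d) \<and> a + b + c + d > 0 \<and>
     a \<le> 0 \<and> 0 \<le> b \<and> b \<le> c \<and> c \<le> d \<and> a + b + c \<ge> d)"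

definition primitive_root_quadruples :: "int \<Rightarrow> (int \<times> int \<times> int \<times> int) set" where
  "primitive_root_quadruples m =
     {(a, b, c, d). root_quadruple (a, b, c, d) \<and> primitive_quadruple (a, b, c, d) \<and>
        Min {a, b, c, d} = m}"

definition N_root_star :: "int \<Rightarrow> nat" where
  "N_root_star m = card (primitive_root_quadruples m)"

text \<open>\<open>BQF A B C\<close> is the form $[A,B,C] = A T^2 + 2 B T U + C U^2$; the cross term is
  \<open>2 * B\<close>, not \<open>B\<close>.\<close>

datatype bqf = BQF (coeff_A: int) (coeff_B: int) (coeff_C: int)

definition bqf_eval :: "bqf \<Rightarrow> 'a::comm_ring_1 ^ 2 \<Rightarrow> 'a" where
  "bqf_eval f v = of_int (coeff_A f) * (v $ 1)\<^sup>2
     + 2 * of_int (coeff_B f) * (v $ 1) * (v $ 2) + of_int (coeff_C f) * (v $ 2)\<^sup>2"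

definition bqf_disc :: "bqf \<Rightarrow> int" where
  "bqf_disc f = 4 * (coeff_B f)\<^sup>2 - 4 * coeff_A f * coeff_C f"

definition bqf_primitive :: "bqf \<Rightarrow> bool" where
  "bqf_primitive f \<longleftrightarrow> Gcd {coeff_A f, coeff_B f, coeff_C f} = 1"

definition bqf_pos_def :: "bqf \<Rightarrow> bool" where
  "bqf_pos_def f \<longleftrightarrow> (\<forall>v :: real ^ 2. v \<noteq> 0 \<longrightarrow> bqf_eval f v > 0)"

definition bqf_reduced :: "bqf \<Rightarrow> bool" where
  "bqf_reduced f \<longleftrightarrow> bqf_pos_def f \<and>
     0 \<le> \<bar>2 * coeff_B f\<bar> \<and> \<bar>2 * coeff_B f\<bar> \<le> coeff_A f \<and> coeff_A f \<le> coeff_C f"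

text \<open>\<open>invertible\<close> is invertibility over the integers here, so the matrix ranges over
  $GL(2,\mathbb{Z})$. A form is determined by its values on integer vectors, so the equality of
  values below is equality of forms.\<close>

definition GL2Z_equiv :: "(bqf \<times> bqf) set" where
  "GL2Z_equiv = {(f, g). \<exists>M :: int ^ 2 ^ 2. invertible M \<and>
     (\<forall>v :: int ^ 2. bqf_eval g v = bqf_eval f (M *v v))}"

definition GL2Z_classes :: "int \<Rightarrow> bqf set set" where
  "GL2Z_classes D = {f. bqf_pos_def f \<and> bqf_primitive f \<and> bqf_disc f = D} // GL2Z_equiv"

definition h_pm :: "int \<Rightarrow> nat" where
  "h_pm D = card (GL2Z_classes D)"

text \<open>The entries of a Descartes quadruple have an even sum, so the integer division below is
  exact on Descartes quadruples.\<close>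

definition quadruple_form :: "int \<times> int \<times> int \<times> int \<Rightarrow> bqf" where
  "quadruple_form = (\<lambda>(a, x, y, z). BQF (a + x) ((a + x + y - z) div 2) (a + y))"

end

theory Submission
  imports Defs "HOL-Analysis.Determinants"
begin

text \<open>Completing the Descartes equation to a square gives
  $(a+x+y-z)^2 = 4((a+x)(a+y)-a^2)$, which is exactly the discriminant condition on the
  associated form; the inequalities of a root quadruple turn into those of a reduced form with
  $B \ge 0$. On the other side, a $GL(2,\mathbb{Z})$-class contains exactly one such form: an
  element with minimal $A$ can be translated and reflected into one. For uniqueness, a reduced form takes
  values at least $A$ at nonzero vectors and at least $C$ when $U \ne 0$; some column of a
  transition matrix has a nonzero second entry, so $A$ and $C$ agree for equivalent reduced forms.\<close>

section \<open>Positive definite forms and changes of variables\<close>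

text \<open>Multiplying the form by A completes the square: $A f(t,u) = (At+Bu)^2 + (AC-B^2)u^2$.
  This trades the quantifier over real vectors for two integer inequalities.\<close>

lemma bqf_pos_def_iff:
  "bqf_pos_def f \<longleftrightarrow> coeff_A f > 0 \<and> bqf_disc f < 0"
proof -
  obtain A B C where f: "f = BQF A B C" by (cases f)
  show ?thesis
  proof
    assume pd: "bqf_pos_def f"
    have *: "real_of_int A * t\<^sup>2 + 2 * real_of_int B * t * u + real_of_int C * u\<^sup>2 > 0"
      if "t \<noteq> 0 \<or> u \<noteq> 0" for t u :: real
    proof -
      have "vector [t, u] \<noteq> (0 :: real ^ 2)"
        using that by (auto simp: vec_eq_iff forall_2)
      with pd show ?thesis
        unfolding bqf_pos_def_def by (force simp: bqf_eval_def f)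
    qed
    have A: "A > 0" using *[of 1 0] by simp
    \<comment> \<open>The vector (-B, A) annihilates the linear term $At+Bu$, so the value there is
      A times $AC-B^2$.\<close>
    have "real_of_int (A * (A * C - B\<^sup>2)) > 0"
      using *[of "- of_int B" "of_int A"] A by (simp add: power2_eq_square algebra_simps)
    then have "A * (A * C - B\<^sup>2) > 0" by linarith
    with A have "A * C - B\<^sup>2 > 0" by (simp add: zero_less_mult_iff)
    with A show "coeff_A f > 0 \<and> bqf_disc f < 0" by (simp add: f bqf_disc_def)
  next
    assume "coeff_A f > 0 \<and> bqf_disc f < 0"
    then have A: "A > 0" and "A * C - B\<^sup>2 > 0" by (auto simp: f bqf_disc_def)
    then have D: "real_of_int A * of_int C - (of_int B)\<^sup>2 > 0"
      by (metis of_int_0_less_iff of_int_diff of_int_mult of_int_power)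
    show "bqf_pos_def f"
      unfolding bqf_pos_def_def
    proof (intro allI impI)
      fix v :: "real ^ 2"
      assume "v \<noteq> 0"
      then have v: "v $ 1 \<noteq> 0 \<or> v $ 2 \<noteq> 0" by (auto simp: vec_eq_iff forall_2)
      have "of_int A * bqf_eval f v
          = (of_int A * v $ 1 + of_int B * v $ 2)\<^sup>2
            + (of_int A * of_int C - (of_int B)\<^sup>2) * (v $ 2)\<^sup>2"
        by (simp add: bqf_eval_def f power2_eq_square algebra_simps)
      also have "\<dots> > 0"
      proof (cases "v $ 2 = 0")
        case True
        with v A show ?thesis by simp
      next
        case False
        with D have "(of_int A * of_int C - (of_int B)\<^sup>2) * (v $ 2)\<^sup>2 > 0" by simp
        then show ?thesis by (simp add: add_nonneg_pos)
      qed
      finally show "bqf_eval f v > 0" using A by (simp add: zero_less_mult_iff)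
    qed
  qed
qed

text \<open>This is $f(pT+qU, rT+sU)$, the pullback along the matrix with rows (p, q) and (r, s).
  Its outer coefficients are the values of f at the columns (p, r) and (q, s).\<close>

definition bqf_subst :: "int \<Rightarrow> int \<Rightarrow> int \<Rightarrow> int \<Rightarrow> bqf \<Rightarrow> bqf" where
  "bqf_subst p q r s f =
     BQF (coeff_A f * p\<^sup>2 + 2 * coeff_B f * p * r + coeff_C f * r\<^sup>2)
         (coeff_A f * p * q + coeff_B f * (p * s + q * r) + coeff_C f * r * s)
         (coeff_A f * q\<^sup>2 + 2 * coeff_B f * q * s + coeff_C f * s\<^sup>2)"

lemma bqf_eval_mult_vec:
  fixes M :: "int ^ 2 ^ 2"
  shows "bqf_eval f (M *v v) = bqf_eval (bqf_subst (M $ 1 $ 1) (M $ 1 $ 2) (M $ 2 $ 1) (M $ 2 $ 2) f) v"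
  by (simp add: bqf_eval_def bqf_subst_def matrix_vector_mult_def sum_2 power2_eq_square algebra_simps)

lemma bqf_eqI_eval:
  assumes "\<And>v :: int ^ 2. bqf_eval f v = bqf_eval g v"
  shows "f = g"
proof -
  have "coeff_A f = coeff_A g" "coeff_C f = coeff_C g"
    using assms[of "vector [1, 0]"] assms[of "vector [0, 1]"] by (simp_all add: bqf_eval_def)
  moreover from this have "coeff_B f = coeff_B g"
    using assms[of "vector [1, 1]"] by (simp add: bqf_eval_def)
  ultimately show ?thesis by (simp add: bqf.expand)
qed

text \<open>The determinant is multiplicative, so it must be a unit of the integers; conversely the
  adjugate supplies an integral inverse.\<close>

lemma invertible_int_2_iff:
  fixes M :: "int ^ 2 ^ 2"
  shows "invertible M \<longleftrightarrow> \<bar>M $ 1 $ 1 * M $ 2 $ 2 - M $ 1 $ 2 * M $ 2 $ 1\<bar> = 1"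
proof
  assume "invertible M"
  then obtain N where "M ** N = mat 1" by (auto simp: invertible_def)
  then have "det M * det N = 1" by (metis det_mul det_I)
  then have "\<bar>det M\<bar> = 1" by (metis zmult_eq_1_iff abs_1 abs_minus_cancel)
  then show "\<bar>M $ 1 $ 1 * M $ 2 $ 2 - M $ 1 $ 2 * M $ 2 $ 1\<bar> = 1" by (simp add: det_2)
next
  assume *: "\<bar>M $ 1 $ 1 * M $ 2 $ 2 - M $ 1 $ 2 * M $ 2 $ 1\<bar> = 1"
  define d where "d = M $ 1 $ 1 * M $ 2 $ 2 - M $ 1 $ 2 * M $ 2 $ 1"
  \<comment> \<open>The adjugate scaled by d; dividing by the determinant is multiplying by it,
    since $d^2 = 1$.\<close>
  define N :: "int ^ 2 ^ 2" where
    "N = vector [vector [d * M $ 2 $ 2, - d * M $ 1 $ 2], vector [- d * M $ 2 $ 1, d * M $ 1 $ 1]]"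
  have "d = 1 \<or> d = - 1" using * unfolding d_def by linarith
  then have "d * d = 1" by auto
  then have "M $ 1 $ 1 * (d * M $ 2 $ 2) - M $ 1 $ 2 * (d * M $ 2 $ 1) = 1"
    unfolding d_def by (simp add: algebra_simps)
  then have "M ** N = mat 1" "N ** M = mat 1"
    by (simp_all add: vec_eq_iff forall_2 matrix_matrix_mult_def sum_2 N_def mat_def algebra_simps)
  then show "invertible M" by (auto simp: invertible_def)
qed

lemma GL2Z_equiv_iff:
  "(f, g) \<in> GL2Z_equiv \<longleftrightarrow> (\<exists>p q r s. \<bar>p * s - q * r\<bar> = 1 \<and> g = bqf_subst p q r s f)"
proof
  assume "(f, g) \<in> GL2Z_equiv"
  then obtain M :: "int ^ 2 ^ 2" where "invertible M"
    and "\<forall>v :: int ^ 2. bqf_eval g v = bqf_eval f (M *v v)"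
    by (auto simp: GL2Z_equiv_def)
  then show "\<exists>p q r s. \<bar>p * s - q * r\<bar> = 1 \<and> g = bqf_subst p q r s f"
    by (metis invertible_int_2_iff bqf_eval_mult_vec bqf_eqI_eval)
next
  assume "\<exists>p q r s. \<bar>p * s - q * r\<bar> = 1 \<and> g = bqf_subst p q r s f"
  then obtain p q r s where *: "\<bar>p * s - q * r\<bar> = 1" and g: "g = bqf_subst p q r s f" by blast
  define M :: "int ^ 2 ^ 2" where "M = vector [vector [p, q], vector [r, s]]"
  have "invertible M" using * by (simp add: invertible_int_2_iff M_def)
  moreover have "bqf_eval g v = bqf_eval f (M *v v)" for v :: "int ^ 2"
    by (simp add: bqf_eval_mult_vec M_def g)
  ultimately show "(f, g) \<in> GL2Z_equiv" by (auto simp: GL2Z_equiv_def)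
qed

lemma bqf_subst_equiv: "\<bar>p * s - q * r\<bar> = 1 \<Longrightarrow> (f, bqf_subst p q r s f) \<in> GL2Z_equiv"
  by (auto simp: GL2Z_equiv_iff)

text \<open>The new entries are those of the matrix product, which is what transitivity of the
  equivalence rests on.\<close>

lemma bqf_subst_subst:
  "bqf_subst p' q' r' s' (bqf_subst p q r s f) =
   bqf_subst (p * p' + q * r') (p * q' + q * s') (r * p' + s * r') (r * q' + s * s') f"
  by (simp add: bqf_subst_def power2_eq_square algebra_simps)

lemma equiv_GL2Z_equiv: "equiv UNIV GL2Z_equiv"
proof (rule equivI)
  show "GL2Z_equiv \<subseteq> UNIV \<times> UNIV" by simp
  show "refl GL2Z_equiv"
  proof (rule reflI)
    fix f
    have "bqf_subst 1 0 0 1 f = f" by (simp add: bqf_subst_def)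
    then show "(f, f) \<in> GL2Z_equiv" using bqf_subst_equiv[of 1 1 0 0 f] by simp
  qed
  show "sym GL2Z_equiv"
  proof (rule symI)
    fix f g
    assume "(f, g) \<in> GL2Z_equiv"
    then obtain p q r s where *: "\<bar>p * s - q * r\<bar> = 1" and g: "g = bqf_subst p q r s f"
      by (auto simp: GL2Z_equiv_iff)
    have "(p * s - q * r)\<^sup>2 = 1" using * by (metis power2_abs one_power2)
    \<comment> \<open>Substituting the adjugate after the matrix is scaling by the determinant,
      which multiplies a quadratic form by the determinant squared.\<close>
    moreover have "bqf_subst s (- q) (- r) p g = BQF ((p * s - q * r)\<^sup>2 * coeff_A f)
        ((p * s - q * r)\<^sup>2 * coeff_B f) ((p * s - q * r)\<^sup>2 * coeff_C f)"
      by (simp add: g bqf_subst_def power2_eq_square algebra_simps)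
    ultimately have "bqf_subst s (- q) (- r) p g = f" by simp
    then show "(g, f) \<in> GL2Z_equiv"
      using bqf_subst_equiv[of s p "- q" "- r" g] * by (simp add: algebra_simps)
  qed
  show "trans GL2Z_equiv"
  proof (rule transI)
    fix f g h
    assume "(f, g) \<in> GL2Z_equiv" "(g, h) \<in> GL2Z_equiv"
    then obtain p q r s p' q' r' s'
      where 1: "\<bar>p * s - q * r\<bar> = 1" "\<bar>p' * s' - q' * r'\<bar> = 1"
        and h: "h = bqf_subst p' q' r' s' (bqf_subst p q r s f)"
      by (auto simp: GL2Z_equiv_iff)
    have "(p * p' + q * r') * (r * q' + s * s') - (p * q' + q * s') * (r * p' + s * r')
        = (p * s - q * r) * (p' * s' - q' * r')"
      by (simp add: algebra_simps)
    then show "(f, h) \<in> GL2Z_equiv"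
      unfolding h bqf_subst_subst using 1 by (intro bqf_subst_equiv) (simp add: abs_mult)
  qed
qed

lemma GL2Z_equiv_sym: "(f, g) \<in> GL2Z_equiv \<Longrightarrow> (g, f) \<in> GL2Z_equiv"
  using equiv_GL2Z_equiv by (meson equivE symD)

lemma GL2Z_equiv_trans:
  "(f, g) \<in> GL2Z_equiv \<Longrightarrow> (g, h) \<in> GL2Z_equiv \<Longrightarrow> (f, h) \<in> GL2Z_equiv"
  using equiv_GL2Z_equiv by (meson equivE transD)

section \<open>Invariants of a class: discriminant, definiteness, primitivity\<close>

lemma GL2Z_equiv_disc:
  assumes "(f, g) \<in> GL2Z_equiv"
  shows "bqf_disc g = bqf_disc f"
proof -
  obtain p q r s where *: "\<bar>p * s - q * r\<bar> = 1" and g: "g = bqf_subst p q r s f"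
    using assms by (auto simp: GL2Z_equiv_iff)
  have "bqf_disc g = (p * s - q * r)\<^sup>2 * bqf_disc f"
    by (simp add: g bqf_subst_def bqf_disc_def power2_eq_square algebra_simps)
  also have "(p * s - q * r)\<^sup>2 = 1" using * by (metis power2_abs one_power2)
  finally show ?thesis by simp
qed

lemma GL2Z_equiv_pos_def:
  assumes "(f, g) \<in> GL2Z_equiv" "bqf_pos_def f"
  shows "bqf_pos_def g"
proof -
  obtain p q r s where *: "\<bar>p * s - q * r\<bar> = 1" and g: "g = bqf_subst p q r s f"
    using assms by (auto simp: GL2Z_equiv_iff)
  have A: "coeff_A f > 0" and D: "bqf_disc f < 0"
    using assms(2) by (auto simp: bqf_pos_def_iff)
  \<comment> \<open>The discriminant is invariant, so only the sign of the leading coefficient is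
    left; that coefficient is f(p, r), treated here by completing the square.\<close>
  have "4 * coeff_A f * coeff_A g
      = 4 * (coeff_A f * p + coeff_B f * r)\<^sup>2 + (- bqf_disc f) * r\<^sup>2"
    by (simp add: g bqf_subst_def bqf_disc_def power2_eq_square algebra_simps)
  also have "\<dots> > 0"
  proof (cases "r = 0")
    case True
    with * have "p \<noteq> 0" by auto
    with True A show ?thesis by simp
  next
    case False
    then have "(- bqf_disc f) * r\<^sup>2 > 0" using D by (intro mult_pos_pos) auto
    then show ?thesis by (intro add_nonneg_pos) auto
  qed
  finally have "coeff_A g > 0" using A by (simp add: zero_less_mult_iff)
  then show ?thesis using D GL2Z_equiv_disc[OF assms(1)] by (simp add: bqf_pos_def_iff)
qed

text \<open>In this shape, primitivity of two tuples can be compared through their common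
  divisors.\<close>

lemma Gcd_int_eq_1_iff:
  fixes A :: "int set"
  shows "Gcd A = 1 \<longleftrightarrow> (\<forall>d. (\<forall>a\<in>A. d dvd a) \<longrightarrow> is_unit d)"
proof
  assume "Gcd A = 1"
  then show "\<forall>d. (\<forall>a\<in>A. d dvd a) \<longrightarrow> is_unit d" by (metis Gcd_greatest)
next
  assume "\<forall>d. (\<forall>a\<in>A. d dvd a) \<longrightarrow> is_unit d"
  then have "is_unit (Gcd A)" using Gcd_dvd by blast
  then show "Gcd A = 1" by (metis is_unit_normalize normalize_Gcd)
qed

text \<open>By symmetry the coefficients of f are integer combinations of those of g, so a common
  divisor for g is one for f.\<close>

lemma GL2Z_equiv_primitive:
  assumes "(f, g) \<in> GL2Z_equiv" "bqf_primitive f"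
  shows "bqf_primitive g"
proof -
  obtain p q r s where "f = bqf_subst p q r s g"
    using GL2Z_equiv_sym[OF assms(1)] by (auto simp: GL2Z_equiv_iff)
  then show ?thesis
    using assms(2) unfolding bqf_primitive_def Gcd_int_eq_1_iff by (auto simp: bqf_subst_def)
qed

section \<open>Reduction theory\<close>

lemma ex_GL2Z_equiv_reduced:
  assumes "bqf_pos_def f"
  shows "\<exists>g. (f, g) \<in> GL2Z_equiv \<and> bqf_reduced g \<and> coeff_B g \<ge> 0"
proof -
  have "(f, f) \<in> GL2Z_equiv" using equiv_GL2Z_equiv by (meson UNIV_I equivE refl_onD)
  \<comment> \<open>Minimizing through \<open>nat\<close> loses nothing, since every form in the
    class is positive definite and has a positive leading coefficient.\<close>
  then obtain g where g: "(f, g) \<in> GL2Z_equiv"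
    and min: "\<And>h. (f, h) \<in> GL2Z_equiv \<Longrightarrow> nat (coeff_A g) \<le> nat (coeff_A h)"
    using ex_has_least_nat[of "\<lambda>h. (f, h) \<in> GL2Z_equiv" f "\<lambda>h. nat (coeff_A h)"] by blast
  have A: "coeff_A g > 0"
    using GL2Z_equiv_pos_def[OF g assms] by (simp add: bqf_pos_def_iff)
  \<comment> \<open>k is B/A rounded to a nearest integer, the floor of B/A + 1/2, so the
    translation by k brings the middle coefficient into [-A/2, A/2].\<close>
  define k where "k = (2 * coeff_B g + coeff_A g) div (2 * coeff_A g)"
  define m where "m = (2 * coeff_B g + coeff_A g) mod (2 * coeff_A g)"
  define B where "B = coeff_B g - k * coeff_A g"
  have "2 * coeff_B g + coeff_A g = (2 * coeff_A g) * k + m"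
    by (simp only: k_def m_def mult_div_mod_eq)
  then have "2 * B = m - coeff_A g" by (simp add: B_def algebra_simps)
  moreover have "0 \<le> m" "m < 2 * coeff_A g" using A by (simp_all add: m_def)
  ultimately have B: "\<bar>2 * B\<bar> \<le> coeff_A g" by linarith
  define h where "h = bqf_subst 1 (- k) 0 1 g"
  \<comment> \<open>The reflection of U has determinant -1; it is available because the group is
    GL(2) and not SL(2).\<close>
  define h' where "h' = (if B \<ge> 0 then h else bqf_subst 1 0 0 (- 1) h)"
  have "(f, h) \<in> GL2Z_equiv"
    unfolding h_def by (rule GL2Z_equiv_trans[OF g bqf_subst_equiv]) simp
  moreover from this have "(f, bqf_subst 1 0 0 (- 1) h) \<in> GL2Z_equiv"
    by (rule GL2Z_equiv_trans[OF _ bqf_subst_equiv]) simp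
  ultimately have equiv: "(f, h') \<in> GL2Z_equiv" by (simp add: h'_def)
  have AB: "coeff_A h' = coeff_A g" "coeff_B h' = \<bar>B\<bar>"
    by (simp_all add: h'_def h_def B_def bqf_subst_def)
  have pd: "bqf_pos_def h'" by (rule GL2Z_equiv_pos_def[OF equiv assms])
  \<comment> \<open>Exchanging the variables makes C a leading coefficient in the same class, so
    minimality yields A \<le> C.\<close>
  have swap: "(f, bqf_subst 0 1 1 0 h') \<in> GL2Z_equiv"
    by (rule GL2Z_equiv_trans[OF equiv bqf_subst_equiv]) simp
  have "coeff_A g \<le> coeff_C h'"
    using min[OF swap] A by (simp add: bqf_subst_def)
  with AB B pd have "bqf_reduced h'" by (simp add: bqf_reduced_def)
  with equiv AB show ?thesis by auto
qed

text \<open>Since |2B| \<le> A, the cross term costs at most A|tu|. It remains to bound $AT^2 - ATU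
  + CU^2$ below by C for T = |t| and U = |u| \<ge> 1.\<close>

lemma bqf_reduced_ge_C:
  assumes "bqf_reduced f" "u \<noteq> 0"
  shows "coeff_A f * t\<^sup>2 + 2 * coeff_B f * t * u + coeff_C f * u\<^sup>2 \<ge> coeff_C f"
proof -
  define A B C where "A = coeff_A f" and "B = coeff_B f" and "C = coeff_C f"
  have h: "\<bar>2 * B\<bar> \<le> A" "A \<le> C" "A > 0"
    using assms(1) by (simp_all add: A_def B_def C_def bqf_reduced_def bqf_pos_def_iff)
  define T U where "T = \<bar>t\<bar>" and "U = \<bar>u\<bar>"
  have U: "U \<ge> 1" and T: "T \<ge> 0" using assms(2) by (simp_all add: U_def T_def)
  have "\<bar>2 * B * t * u\<bar> \<le> A * (T * U)"
    using h(1) mult_right_mono[of "\<bar>2 * B\<bar>" A "T * U"] U T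
    by (simp add: abs_mult T_def U_def mult.assoc)
  then have "A * t\<^sup>2 + 2 * B * t * u + C * u\<^sup>2 \<ge> A * T\<^sup>2 - A * (T * U) + C * U\<^sup>2"
    by (simp add: T_def U_def)
  moreover have "A * T\<^sup>2 - A * (T * U) + C * U\<^sup>2 \<ge> C"
  proof (cases "T \<ge> U")
    case True
    then have "A * T * (T - U) \<ge> 0" using h T by simp
    moreover have "C * U\<^sup>2 \<ge> C * 1" using h U by (intro mult_left_mono) auto
    ultimately show ?thesis by (simp add: power2_eq_square algebra_simps)
  next
    case False
    have "A * (T * (U - T)) \<le> C * (T * (U - T))"
      using h T False by (intro mult_right_mono) auto
    moreover have "T * U - T * T \<le> U * U - 1"
    proof (cases "T = 0")
      case True
      then show ?thesis using U mult_mono[of 1 U 1 U] by simp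
    next
      case F: False
      \<comment> \<open>Integrality turns T < U into T \<le> U - 1; the second factor is then
        enlarged from U - T to U + 1.\<close>
      then have "T * (U - T) \<le> (U - 1) * (U - T)" "(U - 1) * (U - T) \<le> (U - 1) * (U + 1)"
        using F T False U by (auto intro!: mult_right_mono mult_left_mono)
      then show ?thesis by (simp add: algebra_simps)
    qed
    then have "C * (T * U - T * T) \<le> C * (U * U - 1)" using h by (intro mult_left_mono) auto
    ultimately show ?thesis by (simp add: power2_eq_square algebra_simps)
  qed
  ultimately show ?thesis unfolding A_def B_def C_def by linarith
qed

lemma bqf_reduced_ge_A:
  assumes "bqf_reduced f" "t \<noteq> 0 \<or> u \<noteq> 0"
  shows "coeff_A f * t\<^sup>2 + 2 * coeff_B f * t * u + coeff_C f * u\<^sup>2 \<ge> coeff_A f"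
proof (cases "u = 0")
  case True
  then have "t\<^sup>2 \<ge> 1" using assms(2) by (simp add: int_one_le_iff_zero_less)
  then have "coeff_A f * t\<^sup>2 \<ge> coeff_A f * 1"
    using assms(1) by (intro mult_left_mono) (auto simp: bqf_reduced_def)
  with True show ?thesis by simp
next
  case False
  then show ?thesis using bqf_reduced_ge_C[of f u t] assms(1) by (simp add: bqf_reduced_def)
qed

lemma GL2Z_equiv_reduced_le:
  assumes "(f, g) \<in> GL2Z_equiv" "bqf_reduced f" "bqf_reduced g"
  shows "coeff_A f \<le> coeff_A g" "coeff_C f \<le> coeff_C g"
proof -
  obtain p q r s where *: "\<bar>p * s - q * r\<bar> = 1" and g: "g = bqf_subst p q r s f"
    using assms by (auto simp: GL2Z_equiv_iff)
  have "p \<noteq> 0 \<or> r \<noteq> 0" using * by auto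
  then show "coeff_A f \<le> coeff_A g"
    using bqf_reduced_ge_A[OF assms(2), of p r] by (simp add: g bqf_subst_def)
  \<comment> \<open>The columns cannot both have second entry 0. If r is nonzero, the bound reaches
    only the leading coefficient of g, which is at most its last one.\<close>
  have "s \<noteq> 0 \<or> r \<noteq> 0" using * by auto
  then have "coeff_C f \<le> coeff_C g \<or> coeff_C f \<le> coeff_A g"
    using bqf_reduced_ge_C[OF assms(2), of s q] bqf_reduced_ge_C[OF assms(2), of r p]
    by (auto simp: g bqf_subst_def)
  then show "coeff_C f \<le> coeff_C g" using assms(3) by (auto simp: bqf_reduced_def)
qed

text \<open>Inequalities in both directions fix A and C, the discriminant then fixes $B^2$, and the
  sign condition fixes B.\<close>

lemma GL2Z_equiv_reduced_unique:
  assumes "(f, g) \<in> GL2Z_equiv" "bqf_reduced f" "bqf_reduced g" "coeff_B f \<ge> 0" "coeff_B g \<ge> 0"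
  shows "f = g"
proof -
  note le = GL2Z_equiv_reduced_le[OF assms(1-3)]
    GL2Z_equiv_reduced_le[OF GL2Z_equiv_sym[OF assms(1)] assms(3,2)]
  then have AC: "coeff_A f = coeff_A g" "coeff_C f = coeff_C g" by simp_all
  with GL2Z_equiv_disc[OF assms(1)] have "(coeff_B f)\<^sup>2 = (coeff_B g)\<^sup>2"
    by (simp add: bqf_disc_def)
  with assms(4,5) AC show ?thesis by (simp add: bqf.expand)
qed

section \<open>Reduced forms as class representatives, and their finiteness\<close>

lemma bij_betw_reduced_GL2Z_classes:
  "bij_betw (\<lambda>f. GL2Z_equiv `` {f})
     {f. bqf_reduced f \<and> bqf_disc f = D \<and> coeff_B f \<ge> 0 \<and> bqf_primitive f} (GL2Z_classes D)"
proof (rule bij_betwI')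
  fix f g
  assume "f \<in> {f. bqf_reduced f \<and> bqf_disc f = D \<and> coeff_B f \<ge> 0 \<and> bqf_primitive f}"
    and "g \<in> {f. bqf_reduced f \<and> bqf_disc f = D \<and> coeff_B f \<ge> 0 \<and> bqf_primitive f}"
  then show "GL2Z_equiv `` {f} = GL2Z_equiv `` {g} \<longleftrightarrow> f = g"
    using GL2Z_equiv_reduced_unique eq_equiv_class[OF _ equiv_GL2Z_equiv] by blast
next
  fix f
  assume "f \<in> {f. bqf_reduced f \<and> bqf_disc f = D \<and> coeff_B f \<ge> 0 \<and> bqf_primitive f}"
  then show "GL2Z_equiv `` {f} \<in> GL2Z_classes D"
    unfolding GL2Z_classes_def by (intro quotientI) (simp add: bqf_reduced_def)
next
  fix X
  assume "X \<in> GL2Z_classes D"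
  then obtain f where f: "bqf_pos_def f" "bqf_primitive f" "bqf_disc f = D"
    and X: "X = GL2Z_equiv `` {f}"
    by (auto simp: GL2Z_classes_def elim!: quotientE)
  obtain g where g: "(f, g) \<in> GL2Z_equiv" "bqf_reduced g" "coeff_B g \<ge> 0"
    using ex_GL2Z_equiv_reduced[OF f(1)] by blast
  moreover have "X = GL2Z_equiv `` {g}"
    unfolding X by (rule equiv_class_eq[OF equiv_GL2Z_equiv g(1)])
  ultimately show
    "\<exists>g \<in> {f. bqf_reduced f \<and> bqf_disc f = D \<and> coeff_B f \<ge> 0 \<and> bqf_primitive f}.
       X = GL2Z_equiv `` {g}"
    using f GL2Z_equiv_disc[OF g(1)] GL2Z_equiv_primitive[OF g(1)] by blast
qed

lemma finite_bqf_reduced: "finite {f. bqf_reduced f \<and> bqf_disc f = D}"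
proof (rule finite_subset)
  show "{f. bqf_reduced f \<and> bqf_disc f = D}
      \<subseteq> (\<lambda>(A, B, C). BQF A B C) ` ({0..-D} \<times> {D..-D} \<times> {0..-D})"
  proof
    fix f
    assume "f \<in> {f. bqf_reduced f \<and> bqf_disc f = D}"
    moreover obtain A B C where f: "f = BQF A B C" by (cases f)
    ultimately have h: "A > 0" "\<bar>2 * B\<bar> \<le> A" "A \<le> C" and D: "D = 4 * B\<^sup>2 - 4 * A * C"
      by (auto simp: bqf_reduced_def bqf_pos_def_iff bqf_disc_def)
    have "\<bar>2 * B\<bar> * \<bar>2 * B\<bar> \<le> A * C" using h by (intro mult_mono) auto
    then have "4 * B\<^sup>2 \<le> A * C" by (simp add: power2_eq_square abs_mult)
    moreover have "1 * C \<le> A * C" using h by (intro mult_right_mono) auto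
    ultimately have "C \<le> - D" using h D by linarith
    with h have "(A, B, C) \<in> {0..-D} \<times> {D..-D} \<times> {0..-D}" by auto
    then show "f \<in> (\<lambda>(A, B, C). BQF A B C) ` ({0..-D} \<times> {D..-D} \<times> {0..-D})"
      unfolding f by force
  qed
qed auto

section \<open>Descartes quadruples\<close>

text \<open>The inverse of \<open>quadruple_form\<close> with first entry -n; the last entry solves
  2B = -n + x + y - z for z.\<close>

definition form_quadruple :: "int \<Rightarrow> bqf \<Rightarrow> int \<times> int \<times> int \<times> int" where
  "form_quadruple n f = (- n, coeff_A f + n, coeff_C f + n,
     coeff_A f + coeff_C f - 2 * coeff_B f + n)"

lemma descartes_quadruple_iff:
  "descartes_quadruple (a, x, y, z) \<longleftrightarrow> (a + x + y - z)\<^sup>2 = 4 * ((a + x) * (a + y) - a\<^sup>2)"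
  by (auto simp: descartes_quadruple_def power2_eq_square algebra_simps)

lemma descartes_quadruple_even:
  assumes "descartes_quadruple (a, x, y, z)"
  shows "even (a + x + y - z)"
proof -
  have "even ((a + x + y - z)\<^sup>2)" using assms by (simp add: descartes_quadruple_iff)
  then show ?thesis by simp
qed

lemma two_coeff_B_quadruple_form:
  assumes "descartes_quadruple (a, x, y, z)"
  shows "2 * coeff_B (quadruple_form (a, x, y, z)) = a + x + y - z"
  using descartes_quadruple_even[OF assms] by (simp add: quadruple_form_def)

lemma bqf_disc_quadruple_form:
  assumes "descartes_quadruple (a, x, y, z)"
  shows "bqf_disc (quadruple_form (a, x, y, z)) = - 4 * a\<^sup>2"
proof -
  define B where "B = coeff_B (quadruple_form (a, x, y, z))"
  have "(2 * B)\<^sup>2 = 4 * ((a + x) * (a + y) - a\<^sup>2)"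
    using assms unfolding B_def two_coeff_B_quadruple_form[OF assms] descartes_quadruple_iff .
  moreover have "bqf_disc (quadruple_form (a, x, y, z)) = 4 * B\<^sup>2 - 4 * (a + x) * (a + y)"
    by (simp add: bqf_disc_def B_def quadruple_form_def)
  ultimately show ?thesis by (simp add: power2_eq_square algebra_simps)
qed

text \<open>The inequalities match one by one: C - A = y - x, A - 2B = z - y, and 2B = -n + x + y -
  z.\<close>

lemma bqf_reduced_quadruple_form:
  assumes "n > 0" "root_quadruple (- n, x, y, z)"
  shows "bqf_reduced (quadruple_form (- n, x, y, z))"
    and "coeff_B (quadruple_form (- n, x, y, z)) \<ge> 0"
proof -
  have d: "descartes_quadruple (- n, x, y, z)" and i: "x \<le> y" "y \<le> z" "- n + x + y \<ge> z"
    using assms(2) by (auto simp: root_quadruple_def)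
  define f where "f = quadruple_form (- n, x, y, z)"
  note B = two_coeff_B_quadruple_form[OF d, folded f_def]
  have A: "coeff_A f = x - n" and C: "coeff_C f = y - n" by (simp_all add: f_def quadruple_form_def)
  have disc: "bqf_disc f = - 4 * n\<^sup>2" using bqf_disc_quadruple_form[OF d] by (simp add: f_def)
  show B0: "coeff_B (quadruple_form (- n, x, y, z)) \<ge> 0" using B i by (simp flip: f_def)
  \<comment> \<open>The matching gives only A \<ge> 2B \<ge> 0. Strictness comes from the
    discriminant: A = 0 would force $B^2 = -n^2 < 0$.\<close>
  have "coeff_A f \<noteq> 0"
  proof
    assume "coeff_A f = 0"
    with disc have "(coeff_B f)\<^sup>2 = - n\<^sup>2" by (simp add: bqf_disc_def)
    moreover have "n\<^sup>2 > 0" using assms(1) by simp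
    ultimately show False using zero_le_power2[of "coeff_B f"] by linarith
  qed
  with B B0 A i have "coeff_A f > 0" by (simp flip: f_def)
  with disc assms(1) have "bqf_pos_def f" by (simp add: bqf_pos_def_iff)
  with A B C B0 i show "bqf_reduced (quadruple_form (- n, x, y, z))"
    by (simp add: bqf_reduced_def flip: f_def)
qed

lemma form_quadruple_quadruple_form:
  assumes "descartes_quadruple (- n, x, y, z)"
  shows "form_quadruple n (quadruple_form (- n, x, y, z)) = (- n, x, y, z)"
  using two_coeff_B_quadruple_form[OF assms]
  by (simp add: form_quadruple_def) (simp add: quadruple_form_def)

lemma quadruple_form_form_quadruple: "quadruple_form (form_quadruple n f) = f"
  by (cases f) (simp add: form_quadruple_def quadruple_form_def)

text \<open>The same differences are read backwards; the sum of the entries is 2(A + C - B + n),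
  which is positive.\<close>

lemma root_quadruple_form_quadruple:
  assumes "n > 0" "bqf_reduced f" "bqf_disc f = - 4 * n\<^sup>2" "coeff_B f \<ge> 0"
  shows "root_quadruple (form_quadruple n f)"
  using assms
  by (auto simp: root_quadruple_def form_quadruple_def descartes_quadruple_iff bqf_reduced_def
      bqf_pos_def_iff bqf_disc_def power2_eq_square algebra_simps)

section \<open>Common divisors of quadruples and of their forms\<close>

lemma descartes_quadruple_mult_iff:
  "g \<noteq> 0 \<Longrightarrow> descartes_quadruple (g * a, g * x, g * y, g * z) \<longleftrightarrow> descartes_quadruple (a, x, y, z)"
proof -
  assume g: "g \<noteq> 0"
  have "2 * ((g * a)\<^sup>2 + (g * x)\<^sup>2 + (g * y)\<^sup>2 + (g * z)\<^sup>2) = g\<^sup>2 * (2 * (a\<^sup>2 + x\<^sup>2 + y\<^sup>2 + z\<^sup>2))"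
    "(g * a + g * x + g * y + g * z)\<^sup>2 = g\<^sup>2 * (a + x + y + z)\<^sup>2"
    by (simp_all add: power2_eq_square algebra_simps)
  with g show ?thesis by (simp add: descartes_quadruple_def)
qed

lemma bqf_primitive_quadruple_form_iff:
  assumes "a \<noteq> 0" "descartes_quadruple (a, x, y, z)"
  shows "bqf_primitive (quadruple_form (a, x, y, z)) \<longleftrightarrow> primitive_quadruple (a, x, y, z)"
proof -
  define B where "B = coeff_B (quadruple_form (a, x, y, z))"
  have B: "2 * B = a + x + y - z"
    using two_coeff_B_quadruple_form[OF assms(2)] by (simp add: B_def)
  have disc: "B\<^sup>2 = (a + x) * (a + y) - a\<^sup>2"
  proof -
    have "4 * B\<^sup>2 - 4 * (a + x) * (a + y) = - 4 * a\<^sup>2"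
      using bqf_disc_quadruple_form[OF assms(2)]
      by (simp add: bqf_disc_def B_def quadruple_form_def)
    then show ?thesis by (simp add: algebra_simps)
  qed
  have "d dvd a + x \<and> d dvd B \<and> d dvd a + y \<longleftrightarrow> d dvd a \<and> d dvd x \<and> d dvd y \<and> d dvd z" for d
  proof
    assume h: "d dvd a + x \<and> d dvd B \<and> d dvd a + y"
    \<comment> \<open>The discriminant condition recovers a from the form: $d^2$ divides $a^2$,
      hence d divides a.\<close>
    have "d\<^sup>2 dvd (a + x) * (a + y)" "d\<^sup>2 dvd B\<^sup>2"
      using h by (auto simp: power2_eq_square intro: mult_dvd_mono)
    moreover have "a\<^sup>2 = (a + x) * (a + y) - B\<^sup>2" using disc by simp
    ultimately have "d\<^sup>2 dvd a\<^sup>2" by (metis dvd_diff)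
    then have a: "d dvd a" by simp
    with h have xy: "d dvd x" "d dvd y" by (metis dvd_add_right_iff)+
    have "z = a + x + y - 2 * B" using B by simp
    with a xy h show "d dvd a \<and> d dvd x \<and> d dvd y \<and> d dvd z" by simp
  next
    assume "d dvd a \<and> d dvd x \<and> d dvd y \<and> d dvd z"
    then obtain a' x' y' z' where e: "a = d * a'" "x = d * x'" "y = d * y'" "z = d * z'"
      by (auto simp: dvd_def)
    \<comment> \<open>Directly, d is only seen to divide 2B. Since a is nonzero, so is d, and the
      quotient is again a Descartes quadruple; the parity of its entries supplies the missing factor
      2.\<close>
    with assms have "descartes_quadruple (a', x', y', z')"
      by (auto simp: descartes_quadruple_mult_iff)
    then obtain k where "a' + x' + y' - z' = 2 * k"
      by (blast dest: descartes_quadruple_even elim: evenE)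
    moreover have "2 * B = d * (a' + x' + y' - z')" using B e by (simp add: algebra_simps)
    ultimately have "B = d * k" by simp
    then show "d dvd a + x \<and> d dvd B \<and> d dvd a + y" using e by simp
  qed
  moreover have "quadruple_form (a, x, y, z) = BQF (a + x) B (a + y)"
    by (simp add: B_def quadruple_form_def)
  ultimately show ?thesis
    by (simp add: bqf_primitive_def primitive_quadruple_def Gcd_int_eq_1_iff del: Gcd_insert)
qed

text \<open>The ordering in a root quadruple makes its first entry the least one.\<close>

lemma primitive_root_quadruples_eq:
  "primitive_root_quadruples (- n) =
     {(a, x, y, z). root_quadruple (a, x, y, z) \<and> a = - n \<and> primitive_quadruple (a, x, y, z)}"
  by (auto simp: primitive_root_quadruples_def root_quadruple_def)

section \<open>The correspondence and the class number formula\<close>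

theorem theorem4p2:
  fixes n :: int
  assumes "n > 0"
  shows
    "bij_betw quadruple_form
       {(a, x, y, z). root_quadruple (a, x, y, z) \<and> a = -n}
       {f. bqf_reduced f \<and> bqf_disc f = -4 * n\<^sup>2 \<and> coeff_B f \<ge> 0}
     \<and> (\<forall>x y z. root_quadruple (-n, x, y, z) \<longrightarrow>
          coeff_A (quadruple_form (-n, x, y, z)) = -n + x \<and>
          real_of_int (coeff_B (quadruple_form (-n, x, y, z))) =
            1 / 2 * real_of_int (-n + x + y - z) \<and>
          coeff_C (quadruple_form (-n, x, y, z)) = -n + y)
     \<and> bij_betw quadruple_form
       {(a, x, y, z). root_quadruple (a, x, y, z) \<and> a = -n \<and> primitive_quadruple (a, x, y, z)}
       {f. bqf_reduced f \<and> bqf_disc f = -4 * n\<^sup>2 \<and> coeff_B f \<ge> 0 \<and> bqf_primitive f}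
     \<and> finite (primitive_root_quadruples (-n))
     \<and> finite (GL2Z_classes (-4 * n\<^sup>2))
     \<and> N_root_star (-n) = h_pm (-4 * n\<^sup>2)"
proof -
  let ?Q = "{(a, x, y, z). root_quadruple (a, x, y, z) \<and> a = - n}"
  let ?F = "{f. bqf_reduced f \<and> bqf_disc f = - 4 * n\<^sup>2 \<and> coeff_B f \<ge> 0}"
  let ?Q' = "{(a, x, y, z). root_quadruple (a, x, y, z) \<and> a = - n \<and> primitive_quadruple (a, x, y, z)}"
  let ?F' = "{f. bqf_reduced f \<and> bqf_disc f = - 4 * n\<^sup>2 \<and> coeff_B f \<ge> 0 \<and> bqf_primitive f}"
  have d: "descartes_quadruple q" if "root_quadruple q" for q
    using that by (auto simp: root_quadruple_def split: prod.splits)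
  have bij: "bij_betw quadruple_form ?Q ?F"
  proof (rule bij_betw_byWitness[where f' = "form_quadruple n"])
    show "\<forall>q\<in>?Q. form_quadruple n (quadruple_form q) = q"
      using d form_quadruple_quadruple_form by auto
    show "\<forall>f\<in>?F. quadruple_form (form_quadruple n f) = f"
      by (simp add: quadruple_form_form_quadruple)
    show "quadruple_form ` ?Q \<subseteq> ?F"
      using bqf_reduced_quadruple_form[OF assms] bqf_disc_quadruple_form[OF d] by auto
    show "form_quadruple n ` ?F \<subseteq> ?Q"
    proof (rule image_subsetI)
      fix f assume "f \<in> ?F"
      then have "root_quadruple (form_quadruple n f)"
        using root_quadruple_form_quadruple[OF assms] by blast
      then show "form_quadruple n f \<in> ?Q" by (simp add: form_quadruple_def)
    qed
  qed
  have prim: "bqf_primitive (quadruple_form q) \<longleftrightarrow> primitive_quadruple q" if "q \<in> ?Q" for q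
    using that bqf_primitive_quadruple_form_iff d assms by auto
  have bij': "bij_betw quadruple_form ?Q' ?F'"
  proof (rule bij_betw_subset[OF bij])
    show "?Q' \<subseteq> ?Q" by auto
    \<comment> \<open>Primitivity is preserved and reflected, so the bijection restricts to the
      primitive objects on both sides.\<close>
    have "?Q' = {q \<in> ?Q. primitive_quadruple q}" by auto
    also have "quadruple_form ` \<dots> = {f \<in> quadruple_form ` ?Q. bqf_primitive f}"
      using prim by auto
    also have "quadruple_form ` ?Q = ?F" by (rule bij_betw_imp_surj_on[OF bij])
    also have "{f \<in> ?F. bqf_primitive f} = ?F'" by auto
    finally show "quadruple_form ` ?Q' = ?F'" .
  qed
  have bij_classes: "bij_betw (\<lambda>f. GL2Z_equiv `` {f}) ?F' (GL2Z_classes (- 4 * n\<^sup>2))"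
    by (rule bij_betw_reduced_GL2Z_classes)
  have fin: "finite ?F'" by (rule finite_subset[OF _ finite_bqf_reduced]) auto
  have coeffs: "\<forall>x y z. root_quadruple (-n, x, y, z) \<longrightarrow>
          coeff_A (quadruple_form (-n, x, y, z)) = -n + x \<and>
          real_of_int (coeff_B (quadruple_form (-n, x, y, z))) =
            1 / 2 * real_of_int (-n + x + y - z) \<and>
          coeff_C (quadruple_form (-n, x, y, z)) = -n + y"
  proof (intro allI impI)
    fix x y z
    assume "root_quadruple (-n, x, y, z)"
    from two_coeff_B_quadruple_form[OF d[OF this]]
    have "2 * real_of_int (coeff_B (quadruple_form (-n, x, y, z))) = real_of_int (-n + x + y - z)"
      by (metis of_int_mult of_int_numeral)
    then show "coeff_A (quadruple_form (-n, x, y, z)) = -n + x \<and>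
          real_of_int (coeff_B (quadruple_form (-n, x, y, z))) =
            1 / 2 * real_of_int (-n + x + y - z) \<and>
          coeff_C (quadruple_form (-n, x, y, z)) = -n + y"
      by simp (simp add: quadruple_form_def)
  qed
  \<comment> \<open>\<open>card\<close> is 0 on infinite sets; finiteness on both sides makes the
    final equation a genuine count.\<close>
  have finQ: "finite (primitive_root_quadruples (- n))"
    using bij_betw_finite[OF bij'] fin by (simp add: primitive_root_quadruples_eq)
  have finC: "finite (GL2Z_classes (- 4 * n\<^sup>2))"
    using bij_betw_finite[OF bij_classes] fin by blast
  have "N_root_star (- n) = h_pm (- 4 * n\<^sup>2)"
    unfolding N_root_star_def h_pm_def primitive_root_quadruples_eq
    using bij_betw_same_card[OF bij'] bij_betw_same_card[OF bij_classes] by (rule trans)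
  with bij coeffs bij' finQ finC show ?thesis by blast
qed

end
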